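(* (Refinement Principle) Suppose we are given groups $G,E,J,H,H_0,H_1,H_2$ and homomorphisms $\delta_1:G\to H$, $\delta_2:G\to E$, $\beta_2:E\to J$, $\beta_1:H_1\to J$, $\varepsilon_1:H\to H_1$, $\varepsilon_2:H\to H_2$, $\gamma_1:H_1\to H_0$, $\gamma_2:H_2\to H_0$ forming a commutative diagram, i.e. $\beta_2\delta_2=\beta_1\varepsilon_1\delta_1$ and $\gamma_1\varepsilon_1=\gamma_2\varepsilon_2$. Suppose that the following are diamonds of groups: - $G_\bullet=(G,E,H,J)$, with maps $\delta_2:G\to E$, $\delta_1:G\to H$, $\beta_2:E\to J$, $\beta_1\varepsilon_1:H\to J$; - $G'_\bullet=(G,\,H_1,\,E\times H_2,\,J\times H_0)$, with maps $\varepsilon_1\delta_1:G\to H_1$, $(\delta_2,\varepsilon_2\delta_1):G\to E\times H_2$, $(\beta_1,\gamma_1):H_1\to J\times H_0$, $\beta_2\times\gamma_2:E\times H_2\to J\times H_0$; - $H_\bullet=(H,H_1,H_2,H_0)$, with maps $\varepsilon_1,\varepsilon_2,\gamma_1,\gamma_2$. Then: 1. If $G'_\bullet$ has the factorization property then so does $H_\bullet$. 2. If $G'_\bullet$ has the factorization property and $H_\bullet$ has the intersection property then $G_\bullet$ has the factorization property. 3. If $G'_\bullet$ has the intersection property then so does $G_\bullet$. 4. If $G'_\bullet$ has the intersection property and $G_\bullet$ has the factorization property then $H_\bullet$ has the intersection property. 5. If $G_\bullet$ and $H_\bullet$ have the intersection property then so does $G'_\bullet$. 6. If $G_\bullet$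 and $H_\bullet$ have the factorization property then so does $G'_\bullet$.
   Context: A diamond of groups $(S,S_1,S_2,S_0)$ consists of groups and homomorphisms $\alpha_i:S\to S_i$, $\beta_i:S_i\to S_0$ ($i=1,2$) with $\beta_1\alpha_1=\beta_2\alpha_2$ such that $(\alpha_1,\alpha_2):S\to S_1\times_{S_0}S_2$ is a monomorphism. It has the intersection property if $(\alpha_1,\alpha_2):S\to S_1\times_{S_0}S_2$ is an isomorphism. It has the factorization property if every element of $S_0$ is of the form $\beta_1(s_1)\beta_2(s_2)$ with $s_i\in S_i$. Notation: $(f,g)$ denotes $a\mapsto(f(a),g(a))$ and $f\times f'$ denotes $(a,a')\mapsto(f(a),f'(a'))$. *)

theory Defs
  imports "HOL-Algebra.Coset"
begin

definition pair_map :: "('a \<Rightarrow> 'b) \<Rightarrow> ('a \<Rightarrow> 'c) \<Rightarrow> 'a \<Rightarrow> 'b \<times> 'c" where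
  "pair_map f g = (\<lambda>a. (f a, g a))"

definition fiber_product ::
  "('b, 'm) monoid_scheme \<Rightarrow> ('c, 'n) monoid_scheme \<Rightarrow> ('b \<Rightarrow> 'd) \<Rightarrow> ('c \<Rightarrow> 'd)
    \<Rightarrow> ('b \<times> 'c) monoid" where
  "fiber_product S1 S2 \<beta>1 \<beta>2 =
    (S1 \<times>\<times> S2)
      \<lparr>carrier := {(s1, s2). s1 \<in> carrier S1 \<and> s2 \<in> carrier S2 \<and> \<beta>1 s1 = \<beta>2 s2}\<rparr>"

definition diamond ::
  "('a, 'k) monoid_scheme \<Rightarrow> ('b, 'm) monoid_scheme \<Rightarrow> ('c, 'n) monoid_scheme
    \<Rightarrow> ('d, 'o) monoid_scheme
    \<Rightarrow> ('a \<Rightarrow> 'b) \<Rightarrow> ('a \<Rightarrow> 'c) \<Rightarrow> ('b \<Rightarrow> 'd) \<Rightarrow> ('c \<Rightarrow> 'd) \<Rightarrow> bool" where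
  "diamond S S1 S2 S0 \<alpha>1 \<alpha>2 \<beta>1 \<beta>2 \<longleftrightarrow>
     group S \<and> group S1 \<and> group S2 \<and> group S0 \<and>
     \<alpha>1 \<in> hom S S1 \<and> \<alpha>2 \<in> hom S S2 \<and> \<beta>1 \<in> hom S1 S0 \<and> \<beta>2 \<in> hom S2 S0 \<and>
     (\<forall>s \<in> carrier S. \<beta>1 (\<alpha>1 s) = \<beta>2 (\<alpha>2 s)) \<and>
     pair_map \<alpha>1 \<alpha>2 \<in> mon S (fiber_product S1 S2 \<beta>1 \<beta>2)"

definition intersection_property ::
  "('a, 'k) monoid_scheme \<Rightarrow> ('b, 'm) monoid_scheme \<Rightarrow> ('c, 'n) monoid_scheme
    \<Rightarrow> ('a \<Rightarrow> 'b) \<Rightarrow> ('a \<Rightarrow> 'c) \<Rightarrow> ('b \<Rightarrow> 'd) \<Rightarrow> ('c \<Rightarrow> 'd) \<Rightarrow> bool" where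
  "intersection_property S S1 S2 \<alpha>1 \<alpha>2 \<beta>1 \<beta>2 \<longleftrightarrow>
     pair_map \<alpha>1 \<alpha>2 \<in> iso S (fiber_product S1 S2 \<beta>1 \<beta>2)"

definition factorization_property ::
  "('b, 'm) monoid_scheme \<Rightarrow> ('c, 'n) monoid_scheme \<Rightarrow> ('d, 'o) monoid_scheme
    \<Rightarrow> ('b \<Rightarrow> 'd) \<Rightarrow> ('c \<Rightarrow> 'd) \<Rightarrow> bool" where
  "factorization_property S1 S2 S0 \<beta>1 \<beta>2 \<longleftrightarrow>
     (\<forall>s0 \<in> carrier S0. \<exists>s1 \<in> carrier S1. \<exists>s2 \<in> carrier S2. s0 = \<beta>1 s1 \<otimes>\<^bsub>S0\<^esub> \<beta>2 s2)"

lemma group_fiber_product: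
  assumes "group S1" "group S2" "group S0" "\<beta>1 \<in> hom S1 S0" "\<beta>2 \<in> hom S2 S0"
  shows "group (fiber_product S1 S2 \<beta>1 \<beta>2)"
proof -
  interpret b1: group_hom S1 S0 \<beta>1
    using assms by (simp add: group_hom_def group_hom_axioms_def)
  interpret b2: group_hom S2 S0 \<beta>2
    using assms by (simp add: group_hom_def group_hom_axioms_def)
  have "group (S1 \<times>\<times> S2)"
    using assms by (simp add: DirProd_group)
  moreover have "subgroup {(s1, s2). s1 \<in> carrier S1 \<and> s2 \<in> carrier S2 \<and> \<beta>1 s1 = \<beta>2 s2} (S1 \<times>\<times> S2)"
    by (rule group.subgroupI[OF calculation])
      (use assms in \<open>auto simp: inv_DirProd mult_DirProd intro!: exI[of _ \<open>\<one>\<^bsub>S1\<^esub>\<close>] exI[of _ \<open>\<one>\<^bsub>S2\<^esub>\<close>]\<close>)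
  ultimately show ?thesis
    unfolding fiber_product_def by (rule group.subgroup_imp_group)
qed

end

theory Submission
  imports Defs
begin

text \<open>
  Inside a diamond the intersection property only asks for surjectivity onto the fibre product.
  Factoring \<open>(1, h0)\<close> and \<open>(j, 1)\<close> in \<open>G'\<close> gives (1) and (2). A compatible triple \<open>(h1, e, h2)\<close>
  lifts in two stages, first \<open>(h1, h2)\<close> to some \<open>h\<close> in \<open>H\<close> and then \<open>(e, h)\<close> to \<open>G\<close>, which is (5);
  for (3), injectivity of \<open>H \<rightarrow> H1 \<times> H2\<close> recovers \<open>h\<close> from its two images. For (4) and (6) one corrects
  an element of \<open>H1\<close> by the image of some \<open>h\<close> in \<open>H\<close> supplied by a factorization in \<open>J\<close>; the
  correction is absorbed in \<open>H0\<close> because \<open>\<gamma>1 \<circ> \<epsilon>1 = \<gamma>2 \<circ> \<epsilon>2\<close>.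
\<close>

text \<open>Injectivity of the monomorphism into the fibre product, in elementwise form: an element
  of \<open>S\<close> is determined by its two images.\<close>

lemma diamond_eqI:
  assumes "diamond S S1 S2 S0 \<alpha>1 \<alpha>2 \<beta>1 \<beta>2" and "x \<in> carrier S" and "y \<in> carrier S"
    and "\<alpha>1 x = \<alpha>1 y" and "\<alpha>2 x = \<alpha>2 y"
  shows "x = y"
  using assms by (auto simp: diamond_def mon_def pair_map_def inj_on_def)

lemma diamond_intersection_property_iff:
  assumes "diamond S S1 S2 S0 \<alpha>1 \<alpha>2 \<beta>1 \<beta>2"
  shows "intersection_property S S1 S2 \<alpha>1 \<alpha>2 \<beta>1 \<beta>2 \<longleftrightarrow>
    (\<forall>s1 \<in> carrier S1. \<forall>s2 \<in> carrier S2. \<beta>1 s1 = \<beta>2 s2 \<longrightarrow>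
      (\<exists>s \<in> carrier S. \<alpha>1 s = s1 \<and> \<alpha>2 s = s2))"
proof -
  let ?F = "fiber_product S1 S2 \<beta>1 \<beta>2"
  have "pair_map \<alpha>1 \<alpha>2 \<in> mon S ?F"
    using assms by (simp add: diamond_def)
  \<comment> \<open>Membership in \<open>mon\<close> already supplies the homomorphism, injectivity
    and the inclusion of the image in \<open>?F\<close>, so only the reverse inclusion is left of
    the isomorphism condition.\<close>
  then have "intersection_property S S1 S2 \<alpha>1 \<alpha>2 \<beta>1 \<beta>2 \<longleftrightarrow> carrier ?F \<subseteq> pair_map \<alpha>1 \<alpha>2 ` carrier S"
    by (auto simp: intersection_property_def iso_def mon_def bij_betw_def dest: hom_carrier)
  then show ?thesis
    by (fastforce simp: fiber_product_def pair_map_def image_iff)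
qed

text \<open>Inversion reverses products, so factoring the inverse of \<open>x\<close> and inverting
  back exchanges the two factors, although \<open>S0\<close> need not be abelian. This reconciles
  the two diamonds over \<open>J\<close>: the factor from \<open>E\<close> comes first in one and
  last in the other.\<close>

lemma factorization_property_swap:
  assumes "group_hom S1 S0 \<beta>1" and "group_hom S2 S0 \<beta>2"
    and "factorization_property S1 S2 S0 \<beta>1 \<beta>2"
  shows "factorization_property S2 S1 S0 \<beta>2 \<beta>1"
  unfolding factorization_property_def
proof
  interpret b1: group_hom S1 S0 \<beta>1 by fact
  interpret b2: group_hom S2 S0 \<beta>2 by fact
  fix x assume x: "x \<in> carrier S0"
  then obtain s1 s2 where s: "s1 \<in> carrier S1" "s2 \<in> carrier S2" "inv\<^bsub>S0\<^esub> x = \<beta>1 s1 \<otimes>\<^bsub>S0\<^esub> \<beta>2 s2"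
    using assms(3) unfolding factorization_property_def by (meson b1.H.inv_closed)
  then have "x = inv\<^bsub>S0\<^esub> (\<beta>1 s1 \<otimes>\<^bsub>S0\<^esub> \<beta>2 s2)"
    using x by (metis b1.H.inv_inv)
  also have "\<dots> = \<beta>2 (inv\<^bsub>S2\<^esub> s2) \<otimes>\<^bsub>S0\<^esub> \<beta>1 (inv\<^bsub>S1\<^esub> s1)"
    using s by (simp add: b1.H.inv_mult_group)
  finally show "\<exists>s2 \<in> carrier S2. \<exists>s1 \<in> carrier S1. x = \<beta>2 s2 \<otimes>\<^bsub>S0\<^esub> \<beta>1 s1"
    using s b1.G.inv_closed b2.G.inv_closed by blast
qed

theorem proposition2p14:
  fixes G :: "('g, 'p1) monoid_scheme" and E :: "('e, 'p2) monoid_scheme"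
    and J :: "('j, 'p3) monoid_scheme" and H :: "('h, 'p4) monoid_scheme"
    and H0 :: "('h0, 'p5) monoid_scheme" and H1 :: "('h1, 'p6) monoid_scheme"
    and H2 :: "('h2, 'p7) monoid_scheme"
    and \<delta>1 :: "'g \<Rightarrow> 'h" and \<delta>2 :: "'g \<Rightarrow> 'e"
    and \<beta>1 :: "'h1 \<Rightarrow> 'j" and \<beta>2 :: "'e \<Rightarrow> 'j"
    and \<epsilon>1 :: "'h \<Rightarrow> 'h1" and \<epsilon>2 :: "'h \<Rightarrow> 'h2"
    and \<gamma>1 :: "'h1 \<Rightarrow> 'h0" and \<gamma>2 :: "'h2 \<Rightarrow> 'h0"
  assumes "group G" and "group E" and "group J" and "group H"
    and "group H0" and "group H1" and "group H2"
    and "\<delta>1 \<in> hom G H" and "\<delta>2 \<in> hom G E"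
    and "\<beta>2 \<in> hom E J" and "\<beta>1 \<in> hom H1 J"
    and "\<epsilon>1 \<in> hom H H1" and "\<epsilon>2 \<in> hom H H2"
    and "\<gamma>1 \<in> hom H1 H0" and "\<gamma>2 \<in> hom H2 H0"
    and "\<And>g. g \<in> carrier G \<Longrightarrow> \<beta>2 (\<delta>2 g) = \<beta>1 (\<epsilon>1 (\<delta>1 g))"
    and "\<And>h. h \<in> carrier H \<Longrightarrow> \<gamma>1 (\<epsilon>1 h) = \<gamma>2 (\<epsilon>2 h)"
    and "diamond G E H J \<delta>2 \<delta>1 \<beta>2 (\<beta>1 \<circ> \<epsilon>1)"
    and "diamond G H1 (E \<times>\<times> H2) (J \<times>\<times> H0)
           (\<epsilon>1 \<circ> \<delta>1) (pair_map \<delta>2 (\<epsilon>2 \<circ> \<delta>1)) (pair_map \<beta>1 \<gamma>1) (map_prod \<beta>2 \<gamma>2)"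
    and "diamond H H1 H2 H0 \<epsilon>1 \<epsilon>2 \<gamma>1 \<gamma>2"
  defines "G_fact \<equiv> factorization_property E H J \<beta>2 (\<beta>1 \<circ> \<epsilon>1)"
    and "G_int \<equiv> intersection_property G E H \<delta>2 \<delta>1 \<beta>2 (\<beta>1 \<circ> \<epsilon>1)"
    and "G'_fact \<equiv> factorization_property H1 (E \<times>\<times> H2) (J \<times>\<times> H0)
           (pair_map \<beta>1 \<gamma>1) (map_prod \<beta>2 \<gamma>2)"
    and "G'_int \<equiv> intersection_property G H1 (E \<times>\<times> H2)
           (\<epsilon>1 \<circ> \<delta>1) (pair_map \<delta>2 (\<epsilon>2 \<circ> \<delta>1)) (pair_map \<beta>1 \<gamma>1) (map_prod \<beta>2 \<gamma>2)"
    and "H_fact \<equiv> factorization_property H1 H2 H0 \<gamma>1 \<gamma>2"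
    and "H_int \<equiv> intersection_property H H1 H2 \<epsilon>1 \<epsilon>2 \<gamma>1 \<gamma>2"
  shows "(G'_fact \<longrightarrow> H_fact) \<and>
         (G'_fact \<and> H_int \<longrightarrow> G_fact) \<and>
         (G'_int \<longrightarrow> G_int) \<and>
         (G'_int \<and> G_fact \<longrightarrow> H_int) \<and>
         (G_int \<and> H_int \<longrightarrow> G'_int) \<and>
         (G_fact \<and> H_fact \<longrightarrow> G'_fact)"
proof -
  interpret d1: group_hom G H \<delta>1 using assms by (simp add: group_hom_def group_hom_axioms_def)
  interpret b1: group_hom H1 J \<beta>1 using assms by (simp add: group_hom_def group_hom_axioms_def)
  interpret b2: group_hom E J \<beta>2 using assms by (simp add: group_hom_def group_hom_axioms_def)
  interpret e1: group_hom H H1 \<epsilon>1 using assms by (simp add: group_hom_def group_hom_axioms_def)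
  interpret e2: group_hom H H2 \<epsilon>2 using assms by (simp add: group_hom_def group_hom_axioms_def)
  interpret c1: group_hom H1 H0 \<gamma>1 using assms by (simp add: group_hom_def group_hom_axioms_def)
  interpret c2: group_hom H2 H0 \<gamma>2 using assms by (simp add: group_hom_def group_hom_axioms_def)
  note comm_H = assms(17)
  note diamond_G = assms(18) and diamond_G' = assms(19) and diamond_H = assms(20)
  have b1e1: "group_hom H J (\<beta>1 \<circ> \<epsilon>1)"
    using diamond_G by (simp add: diamond_def group_hom_def group_hom_axioms_def)
  have G_int: "G_int \<longleftrightarrow> (\<forall>e \<in> carrier E. \<forall>h \<in> carrier H. \<beta>2 e = \<beta>1 (\<epsilon>1 h) \<longrightarrow>
      (\<exists>g \<in> carrier G. \<delta>2 g = e \<and> \<delta>1 g = h))"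
    unfolding G_int_def diamond_intersection_property_iff[OF diamond_G] by simp
  \<comment> \<open>Equality in \<open>J \<times>\<times> H0\<close> splits into components, so the
    fibre product of the large diamond becomes a set of triples with one condition in
    \<open>J\<close> and one in \<open>H0\<close>.\<close>
  have G'_int: "G'_int \<longleftrightarrow> (\<forall>h1 \<in> carrier H1. \<forall>e \<in> carrier E. \<forall>h2 \<in> carrier H2.
      \<beta>1 h1 = \<beta>2 e \<and> \<gamma>1 h1 = \<gamma>2 h2 \<longrightarrow>
      (\<exists>g \<in> carrier G. \<epsilon>1 (\<delta>1 g) = h1 \<and> \<delta>2 g = e \<and> \<epsilon>2 (\<delta>1 g) = h2))"
    unfolding G'_int_def diamond_intersection_property_iff[OF diamond_G']
    by (simp add: pair_map_def)
  have H_int: "H_int \<longleftrightarrow> (\<forall>h1 \<in> carrier H1. \<forall>h2 \<in> carrier H2. \<gamma>1 h1 = \<gamma>2 h2 \<longrightarrow>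
      (\<exists>h \<in> carrier H. \<epsilon>1 h = h1 \<and> \<epsilon>2 h = h2))"
    unfolding H_int_def by (rule diamond_intersection_property_iff[OF diamond_H])
  have G_fact: "G_fact \<longleftrightarrow> (\<forall>j \<in> carrier J. \<exists>e \<in> carrier E. \<exists>h \<in> carrier H.
      j = \<beta>2 e \<otimes>\<^bsub>J\<^esub> \<beta>1 (\<epsilon>1 h))"
    by (simp add: G_fact_def factorization_property_def)
  \<comment> \<open>This order matches the large diamond, where the image of \<open>H1\<close>
    stands on the left in \<open>J\<close>.\<close>
  have G_fact_swap: "G_fact \<longleftrightarrow> (\<forall>j \<in> carrier J. \<exists>h \<in> carrier H. \<exists>e \<in> carrier E.
      j = \<beta>1 (\<epsilon>1 h) \<otimes>\<^bsub>J\<^esub> \<beta>2 e)"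
  proof -
    have "G_fact \<longleftrightarrow> factorization_property H E J (\<beta>1 \<circ> \<epsilon>1) \<beta>2"
      unfolding G_fact_def
      using factorization_property_swap[OF b1e1 b2.group_hom_axioms]
        factorization_property_swap[OF b2.group_hom_axioms b1e1] by blast
    then show ?thesis by (simp add: factorization_property_def)
  qed
  have G'_fact: "G'_fact \<longleftrightarrow> (\<forall>j \<in> carrier J. \<forall>h0 \<in> carrier H0.
      \<exists>h1 \<in> carrier H1. \<exists>e \<in> carrier E. \<exists>h2 \<in> carrier H2.
        j = \<beta>1 h1 \<otimes>\<^bsub>J\<^esub> \<beta>2 e \<and> h0 = \<gamma>1 h1 \<otimes>\<^bsub>H0\<^esub> \<gamma>2 h2)"
    by (simp add: G'_fact_def factorization_property_def pair_map_def)
  have H_fact: "H_fact \<longleftrightarrow> (\<forall>h0 \<in> carrier H0. \<exists>h1 \<in> carrier H1. \<exists>h2 \<in> carrier H2.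
      h0 = \<gamma>1 h1 \<otimes>\<^bsub>H0\<^esub> \<gamma>2 h2)"
    by (simp add: H_fact_def factorization_property_def)
  have "H_fact" if "G'_fact"
    using that unfolding H_fact G'_fact by (meson b1.H.one_closed)
  moreover have "G_fact" if "G'_fact" "H_int"
    unfolding G_fact_swap
  proof
    fix j assume "j \<in> carrier J"
    then obtain h1 e h2 where *: "h1 \<in> carrier H1" "e \<in> carrier E" "h2 \<in> carrier H2"
        "j = \<beta>1 h1 \<otimes>\<^bsub>J\<^esub> \<beta>2 e" "\<one>\<^bsub>H0\<^esub> = \<gamma>1 h1 \<otimes>\<^bsub>H0\<^esub> \<gamma>2 h2"
      using \<open>G'_fact\<close> unfolding G'_fact by (meson c1.H.one_closed)
    \<comment> \<open>The trivial component in \<open>H0\<close> makes \<gamma>1 \<open>h1\<close>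
      inverse to \<gamma>2 \<open>h2\<close>, which puts \<open>h1\<close> and the inverse of
      \<open>h2\<close> in the fibre product.\<close>
    then have "\<gamma>1 h1 = \<gamma>2 (inv\<^bsub>H2\<^esub> h2)"
      by (metis c1.H.inv_equality c1.hom_closed c2.hom_closed c2.hom_inv)
    then obtain h where "h \<in> carrier H" "\<epsilon>1 h = h1"
      using \<open>H_int\<close> * unfolding H_int by (meson e2.H.inv_closed)
    then show "\<exists>h \<in> carrier H. \<exists>e \<in> carrier E. j = \<beta>1 (\<epsilon>1 h) \<otimes>\<^bsub>J\<^esub> \<beta>2 e"
      using * by blast
  qed
  moreover have "G_int" if "G'_int"
    unfolding G_int
  proof (intro ballI impI)
    fix e h assume eh: "e \<in> carrier E" "h \<in> carrier H" "\<beta>2 e = \<beta>1 (\<epsilon>1 h)"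
    \<comment> \<open>The triple being lifted is (\<epsilon>1 \<open>h\<close>, \<open>e\<close>,
      \<epsilon>2 \<open>h\<close>); its condition in \<open>H0\<close> is
      \<open>comm_H\<close>.\<close>
    then obtain g where g: "g \<in> carrier G" "\<epsilon>1 (\<delta>1 g) = \<epsilon>1 h" "\<delta>2 g = e" "\<epsilon>2 (\<delta>1 g) = \<epsilon>2 h"
      using \<open>G'_int\<close> comm_H unfolding G'_int by (metis e1.hom_closed e2.hom_closed)
    then have "\<delta>1 g = h"
      using eh by (intro diamond_eqI[OF diamond_H]) auto
    with g show "\<exists>g \<in> carrier G. \<delta>2 g = e \<and> \<delta>1 g = h" by blast
  qed
  moreover have "H_int" if "G'_int" "G_fact"
    unfolding H_int
  proof (intro ballI impI)
    fix h1 h2 assume h12: "h1 \<in> carrier H1" "h2 \<in> carrier H2" "\<gamma>1 h1 = \<gamma>2 h2"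
    \<comment> \<open>With the factor from \<open>H\<close> on the right, right multiplication by
      the inverse of \<epsilon>1 \<open>h\<close> leaves exactly \<beta>2 \<open>e\<close>.\<close>
    then obtain e h where eh: "e \<in> carrier E" "h \<in> carrier H" "\<beta>1 h1 = \<beta>2 e \<otimes>\<^bsub>J\<^esub> \<beta>1 (\<epsilon>1 h)"
      using \<open>G_fact\<close> unfolding G_fact by (meson b1.hom_closed)
    let ?h1 = "h1 \<otimes>\<^bsub>H1\<^esub> inv\<^bsub>H1\<^esub> \<epsilon>1 h" and ?h2 = "h2 \<otimes>\<^bsub>H2\<^esub> inv\<^bsub>H2\<^esub> \<epsilon>2 h"
    have "\<beta>1 ?h1 = \<beta>2 e"
      using h12 eh by (simp add: b1.H.m_assoc)
    moreover have "\<gamma>1 ?h1 = \<gamma>2 ?h2"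
      using h12 eh by (simp add: comm_H)
    moreover have "?h1 \<in> carrier H1" "?h2 \<in> carrier H2"
      using h12 eh by auto
    ultimately obtain g where g: "g \<in> carrier G" "\<epsilon>1 (\<delta>1 g) = ?h1" "\<epsilon>2 (\<delta>1 g) = ?h2"
      using \<open>G'_int\<close> eh unfolding G'_int by meson
    \<comment> \<open>The correction by \<open>h\<close> is undone: \<delta>1 \<open>g\<close> lifts
      the corrected pair, hence its product with \<open>h\<close> lifts the original one.\<close>
    have "\<epsilon>1 (\<delta>1 g \<otimes>\<^bsub>H\<^esub> h) = h1" "\<epsilon>2 (\<delta>1 g \<otimes>\<^bsub>H\<^esub> h) = h2"
      using g h12 eh by (simp_all add: b1.G.m_assoc e2.H.m_assoc)
    moreover have "\<delta>1 g \<otimes>\<^bsub>H\<^esub> h \<in> carrier H"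
      using g eh by simp
    ultimately show "\<exists>h \<in> carrier H. \<epsilon>1 h = h1 \<and> \<epsilon>2 h = h2" by blast
  qed
  \<comment> \<open>Once \<open>h\<close> lifts \<open>h1\<close> and \<open>h2\<close>, the
    condition \<beta>1 \<open>h1\<close> = \<beta>2 \<open>e\<close> is what allows \<open>e\<close>
    and \<open>h\<close> to be lifted to \<open>G\<close>.\<close>
  moreover have "G'_int" if "G_int" "H_int"
    using that unfolding G'_int G_int H_int by metis
  moreover have "G'_fact" if "G_fact" "H_fact"
    unfolding G'_fact
  proof (intro ballI)
    fix j h0 assume j: "j \<in> carrier J" and "h0 \<in> carrier H0"
    then obtain a b where ab: "a \<in> carrier H1" "b \<in> carrier H2" "h0 = \<gamma>1 a \<otimes>\<^bsub>H0\<^esub> \<gamma>2 b"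
      using \<open>H_fact\<close> unfolding H_fact by meson
    \<comment> \<open>The factorization of \<open>h0\<close> fixes \<open>a\<close>, so what has to
      be factored in \<open>J\<close> is the part of \<open>j\<close> that \<beta>1 \<open>a\<close>
      misses.\<close>
    then have "inv\<^bsub>J\<^esub> \<beta>1 a \<otimes>\<^bsub>J\<^esub> j \<in> carrier J"
      using j by simp
    then obtain h e where he: "h \<in> carrier H" "e \<in> carrier E"
        "inv\<^bsub>J\<^esub> \<beta>1 a \<otimes>\<^bsub>J\<^esub> j = \<beta>1 (\<epsilon>1 h) \<otimes>\<^bsub>J\<^esub> \<beta>2 e"
      using \<open>G_fact\<close> unfolding G_fact_swap by meson
    \<comment> \<open>Appending \<epsilon>1 \<open>h\<close> to \<open>a\<close> corrects the
      component in \<open>J\<close>; prefixing the inverse of \<epsilon>2 \<open>h\<close> to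
      \<open>b\<close> cancels its effect in \<open>H0\<close>, where both images of
      \<open>h\<close> agree.\<close>
    let ?h1 = "a \<otimes>\<^bsub>H1\<^esub> \<epsilon>1 h" and ?h2 = "inv\<^bsub>H2\<^esub> \<epsilon>2 h \<otimes>\<^bsub>H2\<^esub> b"
    have "j = \<beta>1 a \<otimes>\<^bsub>J\<^esub> (inv\<^bsub>J\<^esub> \<beta>1 a \<otimes>\<^bsub>J\<^esub> j)"
      using j ab by (simp flip: b1.H.m_assoc)
    then have "j = \<beta>1 ?h1 \<otimes>\<^bsub>J\<^esub> \<beta>2 e"
      using j ab he by (simp add: b1.H.m_assoc)
    moreover have "h0 = \<gamma>1 ?h1 \<otimes>\<^bsub>H0\<^esub> \<gamma>2 ?h2"
    proof -
      have "\<gamma>2 (\<epsilon>2 h) \<otimes>\<^bsub>H0\<^esub> (inv\<^bsub>H0\<^esub> \<gamma>2 (\<epsilon>2 h) \<otimes>\<^bsub>H0\<^esub> \<gamma>2 b) = \<gamma>2 b"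
        using ab he by (simp flip: c1.H.m_assoc)
      then show ?thesis
        using ab he by (simp add: comm_H c1.H.m_assoc)
    qed
    moreover have "?h1 \<in> carrier H1" "?h2 \<in> carrier H2"
      using ab he by auto
    ultimately show "\<exists>h1 \<in> carrier H1. \<exists>e \<in> carrier E. \<exists>h2 \<in> carrier H2.
        j = \<beta>1 h1 \<otimes>\<^bsub>J\<^esub> \<beta>2 e \<and> h0 = \<gamma>1 h1 \<otimes>\<^bsub>H0\<^esub> \<gamma>2 h2"
      using he by blast
  qed
  ultimately show ?thesis by blast
qed

end
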